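(* Let $q$ be a prime power. For integers $0<\rho<n\le m$, $$K_R(q^m,n,\rho)\le \frac{1}{1-\log_{q^{mn}}\left(q^{mn}-v(\rho)\right)}+1.$$
   Context: For $\mathbf{x}\in \mathrm{GF}(q^m)^n$, $\mathrm{rk}(\mathbf{x})$ is the maximum number of coordinates of $\mathbf{x}$ that are linearly independent over $\mathrm{GF}(q)$; the rank distance is $d_R(\mathbf{x},\mathbf{y})=\mathrm{rk}(\mathbf{x}-\mathbf{y})$. $v(\rho)$ is the number of vectors in a ball of rank radius $\rho$ in $\mathrm{GF}(q^m)^n$. The rank covering radius of a nonempty code $C\subseteq \mathrm{GF}(q^m)^n$ is $\max_{\mathbf{x}}\min_{\mathbf{c}\in C} d_R(\mathbf{x},\mathbf{c})$. $K_R(q^m,n,\rho)$ denotes the minimum number of balls of rank radius $\rho$ needed to cover $\mathrm{GF}(q^m)^n$, i.e. the minimum cardinality of a (not necessarily linear) code $C\subseteq\mathrm{GF}(q^m)^n$ with rank covering radius at most $\rho$. *)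

theory Defs
  imports Complex_Main "HOL-Algebra.Embedded_Algebras" "HOL-Number_Theory.Prime_Powers"
begin

text \<open>
  Throughout, \<open>F\<close> is the big field \<open>GF(q^m)\<close>, \<open>K\<close> is the carrier of its subfield \<open>GF(q)\<close>, and
  \<open>GF(q^m)^n\<close> is the set of lists of length \<open>n\<close> over the carrier of \<open>F\<close>.
\<close>

definition vectors :: "('a, 'b) ring_scheme \<Rightarrow> nat \<Rightarrow> 'a list set" where
  "vectors F n = {x. length x = n \<and> set x \<subseteq> carrier F}"

definition vec_diff :: "('a, 'b) ring_scheme \<Rightarrow> 'a list \<Rightarrow> 'a list \<Rightarrow> 'a list" where
  "vec_diff F x y = map2 (\<lambda>a b. a \<ominus>\<^bsub>F\<^esub> b) x y"

text \<open>
  The list \<open>nths x I\<close> consists of the coordinates of \<open>x\<close> at the positions in \<open>I\<close>, so coordinates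
  are selected by position: equal coordinates at different positions are linearly dependent.
\<close>

definition rk :: "('a, 'b) ring_scheme \<Rightarrow> 'a set \<Rightarrow> 'a list \<Rightarrow> nat" where
  "rk F K x = Max {card I | I. I \<subseteq> {..<length x} \<and> ring.independent F K (nths x I)}"

definition rank_dist :: "('a, 'b) ring_scheme \<Rightarrow> 'a set \<Rightarrow> 'a list \<Rightarrow> 'a list \<Rightarrow> nat" where
  "rank_dist F K x y = rk F K (vec_diff F x y)"

definition rank_ball :: "('a, 'b) ring_scheme \<Rightarrow> 'a set \<Rightarrow> nat \<Rightarrow> 'a list \<Rightarrow> nat \<Rightarrow> 'a list set" where
  "rank_ball F K n c \<rho> = {x \<in> vectors F n. rank_dist F K x c \<le> \<rho>}"

text \<open>
  The size of a ball does not depend on its centre (lemma \<open>card_rank_ball\<close> below); the zero vector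
  is taken as the centre.
\<close>

definition ball_volume :: "('a, 'b) ring_scheme \<Rightarrow> 'a set \<Rightarrow> nat \<Rightarrow> nat \<Rightarrow> nat" where
  "ball_volume F K n \<rho> = card (rank_ball F K n (replicate n \<zero>\<^bsub>F\<^esub>) \<rho>)"

definition covering_radius :: "('a, 'b) ring_scheme \<Rightarrow> 'a set \<Rightarrow> nat \<Rightarrow> 'a list set \<Rightarrow> nat" where
  "covering_radius F K n C =
     Max ((\<lambda>x. Min ((\<lambda>c. rank_dist F K x c) ` C)) ` vectors F n)"

definition K_R :: "('a, 'b) ring_scheme \<Rightarrow> 'a set \<Rightarrow> nat \<Rightarrow> nat \<Rightarrow> nat" where
  "K_R F K n \<rho> =
     Min {card C | C. C \<subseteq> vectors F n \<and> C \<noteq> {} \<and> covering_radius F K n C \<le> \<rho>}"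

lemma card_rank_ball:
  fixes F (structure)
  assumes "ring F" and c: "c \<in> vectors F n"
  shows "card (rank_ball F K n c \<rho>) = ball_volume F K n \<rho>"
proof -
  interpret ring F by fact
  let ?z = "replicate n \<zero>"
  have nthc: "c ! i \<in> carrier F" if "i < n" for i
    using c that by (auto simp: vectors_def dest: nth_mem)
  have vecI: "x \<in> vectors F n \<longleftrightarrow> length x = n \<and> (\<forall>i<n. x ! i \<in> carrier F)" for x
    unfolding vectors_def subset_code(1) all_set_conv_all_nth by auto
  have len: "length c = n" using c by (simp add: vectors_def)
  have add_diff: "a \<oplus> (b \<ominus> a) = b" and diff_add: "(a \<oplus> b) \<ominus> a = b"
    if "a \<in> carrier F" "b \<in> carrier F" for a b
    using that by (simp_all add: a_minus_def) (metis a_comm a_inv_closed add.m_closed r_neg1 r_neg2)+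
  have z: "vec_diff F x ?z = x" if "x \<in> vectors F n" for x
    using that by (auto simp: vecI vec_diff_def a_minus_def intro!: nth_equalityI)
  have "bij_betw (\<lambda>x. vec_diff F x c) (rank_ball F K n c \<rho>) (rank_ball F K n ?z \<rho>)"
  proof (rule bij_betw_byWitness[where f' = "map2 (\<oplus>) c"])
    show "\<forall>x\<in>rank_ball F K n c \<rho>. map2 (\<oplus>) c (vec_diff F x c) = x"
      using nthc len
      by (auto simp: rank_ball_def vecI vec_diff_def add_diff intro!: nth_equalityI)
    show inv: "\<forall>y\<in>rank_ball F K n ?z \<rho>. vec_diff F (map2 (\<oplus>) c y) c = y"
      using nthc len
      by (auto simp: rank_ball_def vecI vec_diff_def diff_add intro!: nth_equalityI)
    have cl: "vec_diff F x c \<in> vectors F n" if "x \<in> vectors F n" for x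
      using that nthc len by (auto simp: vecI vec_diff_def)
    show "(\<lambda>x. vec_diff F x c) ` rank_ball F K n c \<rho> \<subseteq> rank_ball F K n ?z \<rho>"
      using cl z by (auto simp: rank_ball_def rank_dist_def)
    have cl2: "map2 (\<oplus>) c y \<in> vectors F n" if "y \<in> vectors F n" for y
      using that nthc len by (auto simp: vecI)
    show "map2 (\<oplus>) c ` rank_ball F K n ?z \<rho> \<subseteq> rank_ball F K n c \<rho>"
      using inv cl2 z by (auto simp: rank_ball_def rank_dist_def)
  qed
  then show ?thesis
    unfolding ball_volume_def by (rule bij_betw_same_card)
qed

end

theory Submission
  imports Defs
begin

text \<open>
  Greedy covering: by double counting, some ball contains at least the fraction \<open>v(\<rho>) / q^(m n)\<close> of
  the vectors left uncovered so far. Hence \<open>k\<close> balls can be chosen that leave at most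
  \<open>q^(m n) (1 - v(\<rho>) / q^(m n))^k\<close> vectors uncovered, which is less than \<open>1\<close>, so none at all, as
  soon as \<open>k > 1 / (1 - log (q^(m n)) (q^(m n) - v(\<rho>)))\<close>.
\<close>

text \<open>Induction on \<open>k\<close>, adding a point of \<open>Y\<close> that does at least as
  well as the average. Here \<open>w / card Y\<close> is the fraction of \<open>Y\<close> missing a
  given point of \<open>X\<close>; the estimate is multiplied out so that it stays in the
  naturals.\<close>

lemma greedy_cover:
  fixes R :: "'x \<Rightarrow> 'y \<Rightarrow> bool"
  assumes X: "finite X" and Y: "finite Y" "Y \<noteq> {}"
    and w: "\<And>x. x \<in> X \<Longrightarrow> card {y \<in> Y. \<not> R x y} = w"
  shows "\<exists>C\<subseteq>Y. card C \<le> k \<and>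
    card Y ^ k * card {x \<in> X. \<forall>c\<in>C. \<not> R x c} \<le> w ^ k * card X"
proof (induction k)
  case 0
  show ?case by (intro exI[of _ "{}"]) simp
next
  case (Suc k)
  then obtain C where C: "C \<subseteq> Y" "card C \<le> k"
    and le: "card Y ^ k * card {x \<in> X. \<forall>c\<in>C. \<not> R x c} \<le> w ^ k * card X"
    by blast
  define U where "U = {x \<in> X. \<forall>c\<in>C. \<not> R x c}"
  have U: "finite U" "U \<subseteq> X" using X by (auto simp: U_def)
  \<comment> \<open>Double counting of the pairs with \<open>\<not> R x y\<close>: each
    \<open>x\<close> in \<open>U\<close> occurs in exactly \<open>w\<close> of them.\<close>
  have total: "(\<Sum>y\<in>Y. card {x \<in> U. \<not> R x y}) = w * card U"
    using Y(1) U w by (intro sum_multicount) auto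
  have "\<exists>c\<in>Y. card Y * card {x \<in> U. \<not> R x c} \<le> w * card U"
  proof (rule ccontr)
    assume "\<not> ?thesis"
    \<comment> \<open>By \<open>total\<close>, both sides equal
      \<open>card Y * (w * card U)\<close>, so the strict inequality is absurd.\<close>
    then have "(\<Sum>y\<in>Y. w * card U) < (\<Sum>y\<in>Y. card Y * card {x \<in> U. \<not> R x y})"
      using Y by (intro sum_strict_mono) auto
    then show False by (simp add: sum_distrib_left[symmetric] total)
  qed
  then obtain c where c: "c \<in> Y" "card Y * card {x \<in> U. \<not> R x c} \<le> w * card U" by blast
  have eq: "{x \<in> X. \<forall>d\<in>insert c C. \<not> R x d} = {x \<in> U. \<not> R x c}"
    by (auto simp: U_def)
  have "card Y ^ Suc k * card {x \<in> U. \<not> R x c} = card Y ^ k * (card Y * card {x \<in> U. \<not> R x c})"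
    by simp
  also have "\<dots> \<le> card Y ^ k * (w * card U)"
    using c(2) by (rule mult_le_mono2)
  also have "\<dots> = w * (card Y ^ k * card U)" by simp
  also have "\<dots> \<le> w * (w ^ k * card X)"
    using le unfolding U_def by (rule mult_le_mono2)
  finally have "card Y ^ Suc k * card {x \<in> U. \<not> R x c} \<le> w ^ Suc k * card X" by simp
  \<comment> \<open>Only an upper bound, since \<open>c\<close> may already lie in
    \<open>C\<close>.\<close>
  moreover have "card (insert c C) \<le> Suc k"
    using C(2) card_insert_le_m1[of "Suc k" C c] by simp
  ultimately show ?case
    using C(1) c(1) by (intro exI[of _ "insert c C"]) (simp only: eq insert_subset simp_thms)
qed

text \<open>With \<open>L = log N w\<close>, taking logarithms to base \<open>N\<close> turns the
  claim into \<open>k * L + 1 < k\<close>, which is the hypothesis on \<open>k\<close> solved for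
  \<open>1\<close>.\<close>

lemma power_mult_less_if_log_bound:
  fixes N w k :: nat
  assumes w: "w < N" and N: "1 < N"
    and k: "1 / (1 - log (real N) (real w)) < real k"
  shows "w ^ k * N < N ^ k"
proof (cases "w = 0")
  case True
  \<comment> \<open>As \<open>ln 0 = 0\<close>, also \<open>log N 0 = 0\<close>, and the hypothesis
    reads \<open>1 < k\<close>.\<close>
  then have "0 < k" using k by (auto simp: log_def)
  then show ?thesis using True N by (simp add: power_0_left)
next
  case False
  \<comment> \<open>Makes the denominator positive, so that clearing it preserves the
    inequality.\<close>
  have "log N w < 1" using False w N by (simp add: log_less_one_cancel_iff)
  then have "real k * log N w + 1 < real k"
    using k by (simp add: field_simps)
  then have "log N (real (w ^ k * N)) < log N (real (N ^ k))"
    using False N by (simp add: log_mult log_nat_power)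
  then show ?thesis
    using False N by (subst (asm) log_less_cancel_iff) (auto simp del: of_nat_mult of_nat_power)
qed

lemma vectors_iff_nth:
  "x \<in> vectors F n \<longleftrightarrow> length x = n \<and> (\<forall>i<n. x ! i \<in> carrier F)"
  unfolding vectors_def subset_code(1) all_set_conv_all_nth by auto

lemma finite_vectors: "finite (carrier F) \<Longrightarrow> finite (vectors F n)"
  using finite_lists_length_eq[of "carrier F" n] by (simp add: vectors_def conj_commute)

lemma card_vectors: "finite (carrier F) \<Longrightarrow> card (vectors F n) = order F ^ n"
  using card_lists_length_eq[of "carrier F" n]
  by (simp add: vectors_def order_def conj_commute)

context ring
begin

lemma vec_diff_closed:
  "x \<in> vectors R n \<Longrightarrow> y \<in> vectors R n \<Longrightarrow> vec_diff R x y \<in> vectors R n"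
  by (auto simp: vectors_iff_nth vec_diff_def)

lemma vec_diff_zero: "x \<in> vectors R n \<Longrightarrow> vec_diff R x (replicate n \<zero>) = x"
  by (auto simp: vectors_iff_nth vec_diff_def a_minus_def intro!: nth_equalityI)

lemma vec_diff_vec_diff:
  assumes "x \<in> vectors R n" "y \<in> vectors R n"
  shows "vec_diff R x (vec_diff R x y) = y"
proof -
  have "a \<ominus> (a \<ominus> b) = b" if "a \<in> carrier R" "b \<in> carrier R" for a b
    using that by (simp add: a_minus_def minus_add r_neg2)
  then show ?thesis
    using assms by (auto simp: vectors_iff_nth vec_diff_def intro!: nth_equalityI)
qed

text \<open>Here the point is fixed and the centre varies, as the double counting requires. The map
  sending \<open>c\<close> to \<open>x - c\<close> is an involution by
  \<open>vec_diff_vec_diff\<close>, and it carries these centres onto the ball about zero.\<close>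

lemma card_centres:
  assumes "x \<in> vectors R n"
  shows "card {c \<in> vectors R n. rank_dist R K x c \<le> \<rho>} = ball_volume R K n \<rho>"
proof -
  have "bij_betw (vec_diff R x) {c \<in> vectors R n. rank_dist R K x c \<le> \<rho>}
      (rank_ball R K n (replicate n \<zero>) \<rho>)"
    using assms
    by (intro bij_betw_byWitness[where f' = "vec_diff R x"])
       (auto simp: vec_diff_vec_diff rank_ball_def rank_dist_def vec_diff_closed vec_diff_zero)
  then show ?thesis
    unfolding ball_volume_def by (rule bij_betw_same_card)
qed

text \<open>Any nonempty selection of coordinates starts with \<open>\<zero>\<close>, which lies in
  every span, so only the empty selection is independent.\<close>

lemma rk_zero:
  assumes "subfield K R"
  shows "rk R K (replicate n \<zero>) = 0"
proof -
  have zero: "card I = 0" if I: "I \<subseteq> {..<n}" "independent K (nths (replicate n \<zero>) I)" for I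
  proof (rule ccontr)
    assume "card I \<noteq> 0"
    let ?y = "nths (replicate n \<zero>) I"
    have "{i. i < n \<and> i \<in> I} = I" using I(1) by auto
    then have "length ?y = card I" by (simp add: length_nths)
    then have "?y \<noteq> []" using \<open>card I \<noteq> 0\<close> by auto
    then obtain u us where y: "?y = u # us" by (cases ?y) auto
    have "u = \<zero>" using set_nths_subset[of "replicate n \<zero>" I] y by auto
    moreover have "u \<notin> Span K us" and "set us \<subseteq> carrier R"
      using I(2) y independent_backwards(1)[of K u us] independent_in_carrier[of K "u # us"]
      by auto
    ultimately show False using Span_subgroup_props(2)[OF assms] by simp
  qed
  have "0 \<in> {card I | I. I \<subseteq> {..<n} \<and> independent K (nths (replicate n \<zero>) I)}"
    by (intro CollectI exI[of _ "{}"]) (simp add: nths_empty)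
  with zero have "{card I | I. I \<subseteq> {..<n} \<and> independent K (nths (replicate n \<zero>) I)} = {0}"
    by (intro equalityI subsetI) (elim CollectE exE conjE, simp, simp)
  then show ?thesis by (simp add: rk_def)
qed

text \<open>The zero vector lies in the ball about itself. Positivity yields \<open>w < N\<close> in
  the main proof.\<close>

lemma ball_volume_pos:
  assumes "subfield K R" "finite (carrier R)"
  shows "0 < ball_volume R K n \<rho>"
proof -
  let ?z = "replicate n \<zero>"
  have z: "?z \<in> vectors R n" by (auto simp: vectors_iff_nth)
  then have "?z \<in> rank_ball R K n ?z \<rho>"
    by (simp add: rank_ball_def rank_dist_def vec_diff_zero rk_zero[OF assms(1)])
  moreover have "finite (rank_ball R K n ?z \<rho>)"
    using finite_vectors[OF assms(2)] by (simp add: rank_ball_def)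
  ultimately show ?thesis unfolding ball_volume_def card_gt_0_iff by blast
qed

end

lemma covering_radius_le:
  assumes "finite (vectors F n)" "vectors F n \<noteq> {}" "finite C" "C \<noteq> {}"
    and "\<And>x. x \<in> vectors F n \<Longrightarrow> \<exists>c\<in>C. rank_dist F K x c \<le> \<rho>"
  shows "covering_radius F K n C \<le> \<rho>"
  using assms by (auto simp: covering_radius_def Min_le_iff)

lemma K_R_le:
  assumes "finite (vectors F n)" "C \<subseteq> vectors F n" "C \<noteq> {}" "covering_radius F K n C \<le> \<rho>"
  shows "K_R F K n \<rho> \<le> card C"
  unfolding K_R_def
proof (rule Min_le)
  have "{card C | C. C \<subseteq> vectors F n \<and> C \<noteq> {} \<and> covering_radius F K n C \<le> \<rho>}
      \<subseteq> card ` Pow (vectors F n)" by auto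
  then show "finite {card C | C. C \<subseteq> vectors F n \<and> C \<noteq> {} \<and> covering_radius F K n C \<le> \<rho>}"
    using assms(1) finite_subset by blast
qed (use assms in blast)

theorem proposition11:
  fixes F :: "('a, 'b) ring_scheme" and K :: "'a set" and q m n \<rho> :: nat
  assumes "primepow q"
    and "field F" and "order F = q ^ m"
    and "subfield K F" and "card K = q"
    and "0 < \<rho>" and "\<rho> < n" and "n \<le> m"
  shows "real (K_R F K n \<rho>)
    \<le> 1 / (1 - log (real (q ^ (m * n))) (real (q ^ (m * n)) - real (ball_volume F K n \<rho>))) + 1"
proof -
  interpret field F by fact
  let ?X = "vectors F n" and ?v = "ball_volume F K n \<rho>"
  define N where "N = q ^ (m * n)"
  have q: "1 < q" using \<open>primepow q\<close> by (rule primepow_gt_Suc_0[unfolded One_nat_def[symmetric]])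
  then have "0 < order F" using \<open>order F = q ^ m\<close> by simp
  then have fin: "finite (carrier F)" by (simp add: order_gt_0_iff_finite)
  have X: "finite ?X" "card ?X = N"
    using fin by (simp_all add: finite_vectors card_vectors \<open>order F = q ^ m\<close> N_def power_mult)
  have "0 < m * n" using \<open>\<rho> < n\<close> \<open>n \<le> m\<close> by simp
  then have N: "1 < N" using q unfolding N_def by (rule one_less_power[rotated])
  then have ne: "?X \<noteq> {}" using X(2) by auto
  have v: "0 < ?v" "?v \<le> N"
    using ball_volume_pos[OF \<open>subfield K F\<close> fin] X card_mono[OF X(1)]
    by (auto simp: ball_volume_def rank_ball_def)
  define w where "w = N - ?v"
  \<comment> \<open>Since \<open>?v \<le> N\<close>, the truncated subtraction agrees with the real
    one.\<close>
  have w: "w < N" "real w = real N - real ?v" using v by (auto simp: w_def of_nat_diff)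
  define t where "t = 1 / (1 - log (real N) (real w))"
  have t: "0 \<le> t"
    using w(1) N by (cases "w = 0") (auto simp: t_def log_def)
  \<comment> \<open>The least natural number strictly above \<open>t\<close>; rounding up costs at
    most the final \<open>+ 1\<close> of the bound.\<close>
  define k where "k = nat \<lfloor>t\<rfloor> + 1"
  have k: "t < real k" "real k \<le> t + 1" using t by (simp_all add: k_def) linarith
  have uncov: "card {c \<in> ?X. \<not> rank_dist F K x c \<le> \<rho>} = w" if "x \<in> ?X" for x
  proof -
    have "{c \<in> ?X. \<not> rank_dist F K x c \<le> \<rho>} = ?X - {c \<in> ?X. rank_dist F K x c \<le> \<rho>}" by auto
    then show ?thesis
      using card_centres[OF that, of K \<rho>] X by (simp add: card_Diff_subset w_def)
  qed
  from greedy_cover[where R = "\<lambda>x c. rank_dist F K x c \<le> \<rho>" and k = k, OF X(1) X(1) ne uncov]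
  obtain C where C: "C \<subseteq> ?X" "card C \<le> k"
    and le: "N ^ k * card {x \<in> ?X. \<forall>c\<in>C. \<not> rank_dist F K x c \<le> \<rho>} \<le> w ^ k * N"
    unfolding X(2) by blast
  have "w ^ k * N < N ^ k"
    using power_mult_less_if_log_bound[OF w(1) N] k(1) by (simp add: t_def)
  \<comment> \<open>The number of uncovered vectors is a natural number below
    \<open>1\<close>.\<close>
  with le have "N ^ k * card {x \<in> ?X. \<forall>c\<in>C. \<not> rank_dist F K x c \<le> \<rho>} < N ^ k * 1" by linarith
  then have "card {x \<in> ?X. \<forall>c\<in>C. \<not> rank_dist F K x c \<le> \<rho>} = 0"
    unfolding mult_less_cancel1 by simp
  then have cover: "\<exists>c\<in>C. rank_dist F K x c \<le> \<rho>" if "x \<in> ?X" for x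
    using X(1) that by auto
  then have "C \<noteq> {}" using ne by blast
  then have "K_R F K n \<rho> \<le> card C"
    using C(1) X(1) ne cover finite_subset by (intro K_R_le covering_radius_le) auto
  then have "real (K_R F K n \<rho>) \<le> t + 1" using C(2) k(2) by linarith
  then show ?thesis by (simp add: t_def w(2) N_def)
qed

end
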